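(* Let $g,k$ be integers with $2\le k<g$ and let $m\ge2$ be an integer. Then $Y(g,k)$ is a complete Young graph on $m$ nodes (i.e. $Y(g,k)\in K_m$) if and only if there are exactly $m-1$ positive integers $s$ with $s\le k-1$ such that $s\,\frac{g-k}{k^2-1}$ is an integer.
   Context: Throughout, $g,k$ are integers with $2\le k<g$. The labeled directed graph $H(g,k)$ is built as follows. It has a distinguished starting node $[[0,0]]$ and other nodes labeled by pairs $[R,r]$ of integers with $0\le R,r\le k-1$ (the node $[0,0]$ is distinct from the starting node). For a node $[P,p]$ (the starting node being treated as $[0,0]$ for this purpose) there is an edge labeled $(A,a)$ from $[P,p]$ to $[R,r]$ whenever $A,a$ are integers with $0\le A,a\le g-1$, $0\le R,r\le k-1$, $ka+p=A+rg$ and $kA+R=a+Pg$; edges leaving the starting node additionally require $A\neq0\neq a$; no edge enters the starting node. $H(g,k)$ consists of the starting node and all nodes reachable from it. An even pivot node is a node $[a,a]$; an odd pivot node is a node $[r,s]$ with an edge to $[s,r]$; the starting node is not a pivot node. $Y(g,k)$ is obtained from $H(g,k)$ by deleting every node that is not a pivot node and from which no pivot node is reachable, with the incident edges. $Y(g,k)$ is a complete Young graph on $m$ nodes if its nodes other than the starting node are $m$ nodes forming the complete directed graph on them (an edge from each of these nodes to each of these nodes, including a self-loop at each), and there is an edge from the starting node to every node except $[0,0]$. $K_m$ denotes the class of complete Young graphs on $m$ nodes. *)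

theory Defs
  imports Complex_Main "Graph_Theory.Digraph_Component"
begin

datatype young_node = Start | Carry int int

text \<open>
  The node \<open>[R, r]\<close> is \<open>Carry R r\<close>; the starting node \<open>[[0, 0]]\<close> is \<open>Start\<close>, distinct from
  \<open>Carry 0 0\<close> but with the same pair of carries.
\<close>

fun carries :: "young_node \<Rightarrow> int \<times> int" where
  "carries Start = (0, 0)"
| "carries (Carry R r) = (R, r)"

definition young_edge ::
    "int \<Rightarrow> int \<Rightarrow> young_node \<Rightarrow> int \<times> int \<Rightarrow> int \<times> int \<Rightarrow> bool" where
  "young_edge g k u l w \<longleftrightarrow>
     (case (carries u, l, w) of ((P, p), (A, a), (R, r)) \<Rightarrow>
        0 \<le> A \<and> A \<le> g - 1 \<and> 0 \<le> a \<and> a \<le> g - 1 \<and>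
        0 \<le> R \<and> R \<le> k - 1 \<and> 0 \<le> r \<and> r \<le> k - 1 \<and>
        k * a + p = A + r * g \<and> k * A + R = a + P * g \<and>
        (u = Start \<longrightarrow> A \<noteq> 0 \<and> a \<noteq> 0))"

text \<open>
  An arc is a triple of tail, label and head. In the ambient graph every admissible pair of
  carries is a node, whether or not it is reachable from \<open>Start\<close>.
\<close>

type_synonym young_arc = "young_node \<times> (int \<times> int) \<times> young_node"

definition young_nodes :: "int \<Rightarrow> young_node set" where
  "young_nodes k = insert Start {Carry R r | R r. 0 \<le> R \<and> R \<le> k - 1 \<and> 0 \<le> r \<and> r \<le> k - 1}"

definition young_ambient :: "int \<Rightarrow> int \<Rightarrow> (young_node, young_arc) pre_digraph" where
  "young_ambient g k =
     \<lparr> verts = young_nodes k,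
       arcs = {(u, l, Carry R r) | u l R r. u \<in> young_nodes k \<and> young_edge g k u l (R, r)},
       tail = fst,
       head = (\<lambda>e. snd (snd e)) \<rparr>"

definition young_H :: "int \<Rightarrow> int \<Rightarrow> (young_node, young_arc) pre_digraph" where
  "young_H g k = young_ambient g k \<restriction> {v. Start \<rightarrow>\<^sup>*\<^bsub>young_ambient g k\<^esub> v}"

definition even_pivot :: "(young_node, 'e) pre_digraph \<Rightarrow> young_node \<Rightarrow> bool" where
  "even_pivot G v \<longleftrightarrow> v \<in> verts G \<and> (\<exists>a. v = Carry a a)"

definition odd_pivot :: "(young_node, 'e) pre_digraph \<Rightarrow> young_node \<Rightarrow> bool" where
  "odd_pivot G v \<longleftrightarrow> v \<in> verts G \<and> (\<exists>r s. v = Carry r s \<and> Carry r s \<rightarrow>\<^bsub>G\<^esub> Carry s r)"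

definition pivot :: "(young_node, 'e) pre_digraph \<Rightarrow> young_node \<Rightarrow> bool" where
  "pivot G v \<longleftrightarrow> even_pivot G v \<or> odd_pivot G v"

definition young_Y :: "int \<Rightarrow> int \<Rightarrow> (young_node, young_arc) pre_digraph" where
  "young_Y g k =
     young_H g k \<restriction>
       (verts (young_H g k) -
        {v. \<not> pivot (young_H g k) v \<and>
            \<not> (\<exists>w. pivot (young_H g k) w \<and> v \<rightarrow>\<^sup>*\<^bsub>young_H g k\<^esub> w)})"

text \<open>The class \<open>K\<^sub>m\<close> of complete Young graphs on \<open>m\<close> nodes; \<open>Start\<close> is not counted.\<close>

definition complete_young :: "nat \<Rightarrow> (young_node, 'e) pre_digraph set" where
  "complete_young m =
     {G. finite (verts G - {Start}) \<and> card (verts G - {Start}) = m \<and>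
         (\<forall>u \<in> verts G - {Start}. \<forall>v \<in> verts G - {Start}. u \<rightarrow>\<^bsub>G\<^esub> v) \<and>
         (\<forall>v \<in> verts G - {Start}. v \<noteq> Carry 0 0 \<longrightarrow> Start \<rightarrow>\<^bsub>G\<^esub> v)}"

end

theory Submission
  imports Defs
begin

text \<open>
  Put \<open>n = k\<^sup>2 - 1\<close>. Eliminating one digit from the two carry equations shows that an edge from
  \<open>[P, p]\<close> to \<open>[R, r]\<close> forces \<open>n\<close> to divide \<open>(P + k r) g - (R + k p)\<close>. Let \<open>T\<close> be the set of
  \<open>s\<close> in \<open>{0..k-1}\<close> with \<open>n\<close> dividing \<open>s (g - k)\<close>. The nodes \<open>[s, s]\<close> with \<open>s \<in> T\<close> form a complete
  graph. If \<open>T\<close> has a nonzero element \<open>q\<close>, multiplying the congruence of an edge that leaves a node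
  \<open>[s, s]\<close> by \<open>q\<close> gives \<open>n dvd q (r - R)\<close>, so \<open>r = R\<close> by size, and these nodes are all of \<open>H\<close>.

  Conversely, a complete graph on at least two nodes contains a node \<open>[R, r] \<noteq> [0, 0]\<close> with a
  self-loop and an edge from the start. The two congruences yield \<open>k r g \<equiv> R\<close> and \<open>R g \<equiv> k r\<close>
  modulo \<open>n\<close>, hence \<open>n dvd R\<^sup>2 - r\<^sup>2\<close>, again \<open>R = r\<close> by size, and \<open>r\<close> is a nonzero element of \<open>T\<close>.
\<close>

section \<open>Congruences and size bounds modulo \<open>k\<^sup>2 - 1\<close>\<close>

definition diag_carries :: "int \<Rightarrow> int \<Rightarrow> int set" where
  "diag_carries g k = {s. 0 \<le> s \<and> s \<le> k - 1 \<and> (k\<^sup>2 - 1) dvd s * (g - k)}"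

lemma dvd_small_imp_zero:
  fixes n x y z :: int
  assumes "n dvd x * y" "\<bar>x\<bar> \<le> z" "\<bar>y\<bar> \<le> z" "z\<^sup>2 < n"
  shows "x * y = 0"
proof (rule ccontr)
  assume "x * y \<noteq> 0"
  with assms(1) have "\<bar>n\<bar> \<le> \<bar>x * y\<bar>" by (rule dvd_imp_le_int[rotated])
  also have "\<dots> \<le> z * z" using assms(2,3) by (auto simp: abs_mult intro: mult_mono)
  also have "\<dots> < n" using assms(4) by (simp add: power2_eq_square)
  finally show False by simp
qed

lemma pred_square_less:
  assumes "(2::int) \<le> k"
  shows "(k - 1)\<^sup>2 < k\<^sup>2 - 1"
  using assms by (simp add: power2_eq_square algebra_simps)

text \<open>Substituting \<open>A = k * a + p - r * g\<close> into the second carry equation shows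
  that the quotient is the digit \<open>a\<close> itself.\<close>

lemma young_edge_dvd:
  assumes "young_edge g k u (A, a) (R, r)" "carries u = (P, p)"
  shows "(k\<^sup>2 - 1) dvd (P + k * r) * g - (R + k * p)"
proof -
  have "k * a + p = A + r * g" "k * A + R = a + P * g"
    using assms by (auto simp: young_edge_def)
  then have "(P + k * r) * g - (R + k * p) = (k\<^sup>2 - 1) * a"
    by algebra
  then show ?thesis by simp
qed

lemma young_edge_range:
  assumes "young_edge g k u l (R, r)"
  shows "0 \<le> R" "R \<le> k - 1" "0 \<le> r" "r \<le> k - 1"
  using assms by (cases "carries u"; auto simp: young_edge_def split: prod.splits)+

text \<open>Modulo \<open>k\<^sup>2 - 1\<close> the carry \<open>k\<close> is its own inverse.\<close>

lemma dvd_mult_self_inverse: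
  fixes k :: int
  shows "(k\<^sup>2 - 1) dvd k * x \<longleftrightarrow> (k\<^sup>2 - 1) dvd x"
proof
  assume "(k\<^sup>2 - 1) dvd k * x"
  then have "(k\<^sup>2 - 1) dvd k * (k * x) - (k\<^sup>2 - 1) * x"
    by (intro dvd_diff[OF dvd_mult dvd_triv_left])
  moreover have "k * (k * x) - (k\<^sup>2 - 1) * x = x"
    by (simp add: power2_eq_square algebra_simps)
  ultimately show "(k\<^sup>2 - 1) dvd x" by simp
qed simp

text \<open>The first hypothesis is the congruence of an edge from carries \<open>(0, 0)\<close> to
  \<open>(r, r)\<close>. Reducing it modulo \<open>k\<^sup>2 - 1\<close> leaves a factor
  \<open>k\<close>, which is invertible.\<close>

lemma diag_edge_from_origin:
  assumes "(k\<^sup>2 - 1) dvd k * r * g - r" "0 \<le> r" "r \<le> k - 1"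
  shows "r \<in> diag_carries g k"
proof -
  have "(k\<^sup>2 - 1) dvd (k * r * g - r) - (k\<^sup>2 - 1) * r"
    by (rule dvd_diff[OF assms(1) dvd_triv_left])
  also have "(k * r * g - r) - (k\<^sup>2 - 1) * r = k * (r * (g - k))"
    by (simp add: power2_eq_square algebra_simps)
  finally show ?thesis
    using assms dvd_mult_self_inverse by (auto simp: diag_carries_def)
qed

lemma young_edge_from_diag:
  assumes "2 \<le> k" "q \<in> diag_carries g k" "q \<noteq> 0"
    and "young_edge g k u l (R, r)" "carries u = (s, s)" "s \<in> diag_carries g k"
  shows "R = r" "r \<in> diag_carries g k"
proof -
  let ?n = "k\<^sup>2 - 1"
  obtain A a where "l = (A, a)" by (cases l)
  then have "?n dvd (s + k * r) * g - (R + k * s)"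
    using young_edge_dvd assms(4,5) by blast
  moreover have "?n dvd s * (g - k)" using assms(6) by (simp add: diag_carries_def)
  ultimately have "?n dvd ((s + k * r) * g - (R + k * s)) - s * (g - k)" by (rule dvd_diff)
  also have "((s + k * r) * g - (R + k * s)) - s * (g - k) = k * r * g - R"
    by (simp add: algebra_simps)
  finally have E: "?n dvd k * r * g - R" .
  have q: "?n dvd q * (g - k)" "0 \<le> q" "q \<le> k - 1" using assms(2) by (auto simp: diag_carries_def)
  note rng = young_edge_range[OF assms(4)]
  \<comment> \<open>Since \<open>q * g\<close> is congruent to \<open>q * k\<close> and
    \<open>k\<^sup>2\<close> to 1, the term \<open>q * k * r * g\<close> reduces to
    \<open>q * r\<close>.\<close>
  have "?n dvd q * (k * r * g - R) - ((q * (g - k)) * (k * r) + ?n * (q * r))"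
    by (rule dvd_diff[OF dvd_mult[OF E] dvd_add[OF dvd_mult2[OF q(1)] dvd_triv_left]])
  also have "q * (k * r * g - R) - ((q * (g - k)) * (k * r) + ?n * (q * r)) = q * (r - R)"
    by (simp add: power2_eq_square algebra_simps)
  finally have "q * (r - R) = 0"
    using q rng pred_square_less[OF assms(1)] by (intro dvd_small_imp_zero[where z = "k - 1"]) auto
  then show "R = r" using assms(3) by simp
  with E rng show "r \<in> diag_carries g k" by (intro diag_edge_from_origin) auto
qed

text \<open>With \<open>s * (g - k) = n * i\<close> and \<open>t * (g - k) = n * j\<close>, solving
  the carry equations gives the digits \<open>A = k * i + j + s\<close> and
  \<open>a = k * j + i + t\<close>. What remains is to check their range.\<close>

lemma young_edge_diag:
  assumes "2 \<le> k" "k < g" "s \<in> diag_carries g k" "t \<in> diag_carries g k"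
    and "u = Carry s s \<or> u = Start \<and> s = 0 \<and> t \<noteq> 0"
  shows "\<exists>l. young_edge g k u l (t, t)"
proof -
  define n where "n = k\<^sup>2 - 1"
  have "k * k \<ge> 2 * 2" using assms(1) by (intro mult_mono) auto
  then have n: "n > 0" by (simp add: n_def power2_eq_square)
  have s: "0 \<le> s" "s \<le> k - 1" and t: "0 \<le> t" "t \<le> k - 1"
    using assms(3,4) by (auto simp: diag_carries_def)
  obtain i where i: "s * (g - k) = n * i"
    using assms(3) by (auto simp: diag_carries_def n_def elim: dvdE)
  obtain j where j: "t * (g - k) = n * j"
    using assms(4) by (auto simp: diag_carries_def n_def elim: dvdE)
  have i0: "i \<ge> 0" using i n s(1) assms(2)
    by (metis diff_ge_0_iff_ge less_imp_le mult_nonneg_nonneg zero_le_mult_iff not_less)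
  have j0: "j \<ge> 0" using j n t(1) assms(2)
    by (metis diff_ge_0_iff_ge less_imp_le mult_nonneg_nonneg zero_le_mult_iff not_less)
  \<comment> \<open>One bound serves both digits. As \<open>k * b + z\<close> is at most
    \<open>n\<close>, a digit of size \<open>g\<close> or more would force \<open>b = z = 0\<close>,
    and then \<open>n * g \<le> 0\<close>.\<close>
  have digit_less: "k * x + y + b \<le> g - 1"
    if "x \<ge> 0" "y \<ge> 0" "0 \<le> b" "b \<le> k - 1" "0 \<le> z" "z \<le> k - 1"
      "z * (g - k) = n * y" "b * (g - k) = n * x" for x y z b
  proof (rule ccontr)
    assume "\<not> ?thesis"
    then have "n * g \<le> n * (k * x + y + b)" using n by simp
    also have "n * (k * x + y + b) = (k * b + z) * g - (b + k * z)"
      using that(7,8) unfolding n_def by algebra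
    finally have le: "n * g + (b + k * z) \<le> (k * b + z) * g" by simp
    have "k * b \<le> k * (k - 1)" using that assms(1) by (intro mult_left_mono) auto
    then have kb: "k * b + z \<le> n"
      using that(6) by (simp add: n_def power2_eq_square algebra_simps)
    then have "(k * b + z) * g \<le> n * g" using assms(1,2) by (intro mult_right_mono) auto
    moreover have "k * z \<ge> 0" using that assms(1) by simp
    ultimately have "b = 0" "k * z = 0" using le that(3) by linarith+
    then have "z = 0" using assms(1) by simp
    with \<open>b = 0\<close> le n assms(1,2) show False by (auto simp: mult_le_0_iff)
  qed
  have bounds: "k * i + j + s \<le> g - 1" "k * j + i + t \<le> g - 1"
    using digit_less i j i0 j0 s t by blast+
  \<comment> \<open>This makes both digits nonzero, as edges leaving \<open>Start\<close>
    require.\<close>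
  have j_pos: "0 < j" if "t \<noteq> 0"
    using that j j0 t n assms(2) by (cases "j = 0") auto
  have "k * (k * j + i + t) + s = (k * i + j + s) + t * g"
    "k * (k * i + j + s) + t = (k * j + i + t) + s * g"
    using i j unfolding n_def by algebra+
  moreover have nonneg: "0 \<le> k * i" "0 \<le> k * j" using assms(1) i0 j0 by auto
  moreover have "0 < k * i + j + s \<and> 0 < k * j + i + t" if "t \<noteq> 0"
    using j_pos[OF that] that nonneg i0 s t by linarith
  ultimately have "young_edge g k u (k * i + j + s, k * j + i + t) (t, t)"
    using assms(1,5) bounds i0 j0 s t i n assms(2)
    by (auto simp: young_edge_def)
  then show ?thesis by blast
qed

section \<open>Reachability from the start and completeness of Y\<close>

lemma dominates_young_ambient_iff:
  "u \<rightarrow>\<^bsub>young_ambient g k\<^esub> v \<longleftrightarrow>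
     u \<in> young_nodes k \<and> (\<exists>l R r. v = Carry R r \<and> young_edge g k u l (R, r))"
  by (force simp: young_ambient_def arcs_ends_def arc_to_ends_def)

lemma dominates_induce_subgraph_iff:
  "u \<rightarrow>\<^bsub>G \<restriction> S\<^esub> v \<longleftrightarrow> u \<rightarrow>\<^bsub>G\<^esub> v \<and> u \<in> S \<and> v \<in> S"
  by (auto simp: arcs_ends_def arc_to_ends_def)

context
  fixes g k :: int
  assumes k2: "2 \<le> k" and kg: "k < g"
begin

lemma zero_in_diag_carries: "0 \<in> diag_carries g k"
  using k2 by (auto simp: diag_carries_def)

lemma finite_diag_carries: "finite (diag_carries g k)"
  by (rule finite_subset[of _ "{0..k - 1}"]) (auto simp: diag_carries_def)

lemma dominates_diag:
  assumes "s \<in> diag_carries g k" "t \<in> diag_carries g k"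
    and "u = Carry s s \<or> u = Start \<and> t \<noteq> 0"
  shows "u \<rightarrow>\<^bsub>young_ambient g k\<^esub> Carry t t"
proof -
  have "u \<in> young_nodes k"
    using assms by (auto simp: young_nodes_def diag_carries_def)
  moreover have "\<exists>l. young_edge g k u l (t, t)"
    using assms young_edge_diag[OF k2 kg] zero_in_diag_carries by blast
  ultimately show ?thesis by (auto simp: dominates_young_ambient_iff)
qed

lemma reachable_iff_diag:
  assumes q: "q \<in> diag_carries g k" "q \<noteq> 0"
  shows "Start \<rightarrow>\<^sup>*\<^bsub>young_ambient g k\<^esub> v \<longleftrightarrow>
    v = Start \<or> (\<exists>s \<in> diag_carries g k. v = Carry s s)"
proof
  assume "Start \<rightarrow>\<^sup>*\<^bsub>young_ambient g k\<^esub> v"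
  then show "v = Start \<or> (\<exists>s \<in> diag_carries g k. v = Carry s s)"
    unfolding reachable_def
  proof (induction rule: rtrancl_on_induct)
    case (step y z)
    then obtain s where s: "s \<in> diag_carries g k" "carries y = (s, s)"
      using zero_in_diag_carries by auto
    obtain l R r where "z = Carry R r" "young_edge g k y l (R, r)"
      using step(2) by (auto simp: dominates_young_ambient_iff)
    then show ?case using young_edge_from_diag[OF k2 q _ s(2,1)] by blast
  qed simp
next
  have start: "Start \<rightarrow>\<^sup>*\<^bsub>young_ambient g k\<^esub> Start"
    by (simp add: reachable_def young_ambient_def young_nodes_def)
  have step: "Start \<rightarrow>\<^sup>*\<^bsub>young_ambient g k\<^esub> Carry t t"
    if "Start \<rightarrow>\<^sup>*\<^bsub>young_ambient g k\<^esub> u" "u \<rightarrow>\<^bsub>young_ambient g k\<^esub> Carry t t"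
      "t \<in> diag_carries g k" for u t
  proof -
    have "Carry t t \<in> verts (young_ambient g k)"
      using that(3) by (simp add: young_ambient_def young_nodes_def diag_carries_def)
    then show ?thesis
      using that by (auto simp: reachable_def intro: rtrancl_on_into_rtrancl_on)
  qed
  assume "v = Start \<or> (\<exists>s \<in> diag_carries g k. v = Carry s s)"
  then consider "v = Start" | s where "s \<in> diag_carries g k" "v = Carry s s" by blast
  then show "Start \<rightarrow>\<^sup>*\<^bsub>young_ambient g k\<^esub> v"
  proof cases
    case 2
    \<comment> \<open>\<open>Carry 0 0\<close> has no edge from \<open>Start\<close>, so every
      diagonal node is reached by way of \<open>Carry q q\<close>.\<close>
    have "Start \<rightarrow>\<^sup>*\<^bsub>young_ambient g k\<^esub> Carry q q"
      using q by (intro step[OF start] dominates_diag[OF zero_in_diag_carries]) auto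
    then show ?thesis
      using 2 q by (auto intro: step dominates_diag)
  qed (simp add: start)
qed

text \<open>Every node of H other than \<open>Start\<close> is an even pivot, and
  \<open>Start\<close> reaches one, so passing to Y deletes nothing.\<close>

lemma young_Y_complete:
  assumes q: "q \<in> diag_carries g k" "q \<noteq> 0"
  shows "young_Y g k \<in> complete_young (card (diag_carries g k))"
proof -
  let ?D = "(\<lambda>s. Carry s s) ` diag_carries g k"
  have verts_H: "verts (young_H g k) = insert Start ?D"
    using reachable_iff_diag[OF q] by (auto simp: young_H_def)
  have "pivot (young_H g k) v" if "v \<in> ?D" for v
    using that verts_H by (auto simp: pivot_def even_pivot_def)
  moreover have "Start \<rightarrow>\<^sup>*\<^bsub>young_H g k\<^esub> Carry q q"
  proof -
    have "Start \<rightarrow>\<^bsub>young_H g k\<^esub> Carry q q"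
      using q verts_H unfolding young_H_def
      by (auto simp: dominates_induce_subgraph_iff intro: dominates_diag[OF zero_in_diag_carries])
    then show ?thesis
      unfolding reachable_def using q verts_H
      by (auto intro: rtrancl_on_into_rtrancl_on)
  qed
  ultimately have verts_Y: "verts (young_Y g k) = insert Start ?D"
    using q by (auto simp: young_Y_def verts_H)
  have dom: "u \<rightarrow>\<^bsub>young_Y g k\<^esub> Carry t t"
    if "u = Carry s s \<or> u = Start \<and> t \<noteq> 0" "s \<in> diag_carries g k" "t \<in> diag_carries g k" for u s t
    using that verts_Y verts_H dominates_diag[of s t u]
    by (auto simp: young_Y_def young_H_def dominates_induce_subgraph_iff)
  have "card ?D = card (diag_carries g k)"
    by (intro card_image inj_onI) auto
  moreover have "verts (young_Y g k) - {Start} = ?D" using verts_Y by auto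
  ultimately show ?thesis
    using finite_diag_carries zero_in_diag_carries dom
    unfolding complete_young_def mem_Collect_eq by (auto simp del: finite_Diff_insert)
qed

section \<open>From a complete graph back to a nonzero diagonal carry\<close>

lemma looped_start_successor_diag:
  assumes start: "young_edge g k Start l (R, r)" and loop: "young_edge g k (Carry R r) l' (R, r)"
  shows "R = r" "r \<in> diag_carries g k"
proof -
  let ?n = "k\<^sup>2 - 1"
  have S: "?n dvd k * r * g - R"
    using young_edge_dvd[of g k Start "fst l" "snd l" R r 0 0] start by simp
  have "?n dvd (R + k * r) * g - (R + k * r)"
    using young_edge_dvd[of g k "Carry R r" "fst l'" "snd l'" R r R r] loop by simp
  from dvd_diff[OF this S] have Rg: "?n dvd R * g - k * r" by (simp add: algebra_simps)
  \<comment> \<open>The product \<open>k * r * R * g\<close> is congruent to \<open>R * R\<close> by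
    \<open>S\<close> and to \<open>k * r * (k * r)\<close>, hence to \<open>r * r\<close>, by
    \<open>Rg\<close>.\<close>
  have "?n dvd R * (k * r * g - R) - k * r * (R * g - k * r) - ?n * (r * r)"
    by (rule dvd_diff[OF dvd_diff[OF dvd_mult[OF S] dvd_mult[OF Rg]] dvd_triv_left])
  also have "R * (k * r * g - R) - k * r * (R * g - k * r) - ?n * (r * r) = r * r - R * R"
    by (simp add: power2_eq_square algebra_simps)
  finally have dvd: "?n dvd r * r - R * R" .
  note rng = young_edge_range[OF start]
  \<comment> \<open>Both squares lie between 0 and \<open>(k - 1)\<^sup>2\<close>, so their
    difference is smaller than the modulus.\<close>
  have "r * r \<le> (k - 1) * (k - 1)" "R * R \<le> (k - 1) * (k - 1)"
    using rng by (auto intro!: mult_mono)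
  then have "\<bar>r * r - R * R\<bar> < ?n"
    using pred_square_less[OF k2] zero_le_square[of r] zero_le_square[of R]
    unfolding power2_eq_square by linarith
  with dvd have "r * r = R * R"
    using dvd_imp_le_int[of "r * r - R * R" ?n] by fastforce
  then show "R = r" using rng by (simp flip: power2_eq_square)
  with S rng show "r \<in> diag_carries g k" by (intro diag_edge_from_origin) auto
qed

lemma complete_young_imp_nonzero_diag:
  assumes "young_Y g k \<in> complete_young m" "2 \<le> m"
  shows "\<exists>q \<in> diag_carries g k. q \<noteq> 0"
proof -
  let ?V = "verts (young_Y g k) - {Start}"
  \<comment> \<open>\<open>2 \<le> m\<close> supplies a node other than \<open>Carry 0 0\<close>;
    completeness gives it both a loop and an edge from \<open>Start\<close>.\<close>
  have "\<not> ?V \<subseteq> {Carry 0 0}"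
    using assms card_mono[of "{Carry 0 0}" ?V] by (auto simp: complete_young_def)
  then obtain v where v: "v \<in> ?V" "v \<noteq> Carry 0 0" by blast
  then have "Start \<rightarrow>\<^bsub>young_Y g k\<^esub> v" "v \<rightarrow>\<^bsub>young_Y g k\<^esub> v"
    using assms(1) by (auto simp: complete_young_def)
  then obtain l R r l' where "v = Carry R r" "young_edge g k Start l (R, r)"
    "young_edge g k (Carry R r) l' (R, r)"
    by (auto simp: young_Y_def young_H_def dominates_induce_subgraph_iff
        dominates_young_ambient_iff)
  then show ?thesis using looped_start_successor_diag v(2) by blast
qed

end

theorem theorem4:
  fixes g k :: int and m :: nat
  assumes "2 \<le> k" and "k < g" and "2 \<le> m"
  shows "young_Y g k \<in> complete_young m \<longleftrightarrow>
    card {s :: int. 0 < s \<and> s \<le> k - 1 \<and>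
      real_of_int s * (real_of_int (g - k) / real_of_int (k^2 - 1)) \<in> \<int>} = m - 1"
    (is "_ \<longleftrightarrow> card ?S = _")
proof -
  have "k\<^sup>2 - 1 \<noteq> 0" using assms(1) pred_square_less[of k] zero_le_power2[of "k - 1"] by linarith
  then have "real_of_int s * (real_of_int (g - k) / real_of_int (k\<^sup>2 - 1)) \<in> \<int> \<longleftrightarrow>
      (k\<^sup>2 - 1) dvd s * (g - k)" for s
    using of_int_div_of_int_in_Ints_iff[of "s * (g - k)" "k\<^sup>2 - 1", where 'a = real] by simp
  \<comment> \<open>The removed 0 stands for the node \<open>Carry 0 0\<close>, whence
    \<open>m - 1\<close> rather than \<open>m\<close>.\<close>
  then have S: "?S = diag_carries g k - {0}" by (auto simp: diag_carries_def)
  have card_S: "card ?S = card (diag_carries g k) - 1"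
    unfolding S using zero_in_diag_carries[OF assms(1,2)] by (rule card_Diff_singleton)
  show ?thesis
  proof
    assume Y: "young_Y g k \<in> complete_young m"
    then obtain q where "q \<in> diag_carries g k" "q \<noteq> 0"
      using complete_young_imp_nonzero_diag[OF assms(1,2) _ assms(3)] by blast
    then have "young_Y g k \<in> complete_young (card (diag_carries g k))"
      by (rule young_Y_complete[OF assms(1,2)])
    \<comment> \<open>A graph lies in \<open>complete_young\<close> for only one number of
      nodes.\<close>
    with Y have "card (diag_carries g k) = m" by (simp add: complete_young_def)
    with card_S show "card ?S = m - 1" by simp
  next
    assume card: "card ?S = m - 1"
    with assms(3) have "diag_carries g k - {0} \<noteq> {}" unfolding S by (intro notI) simp
    then obtain q where "q \<in> diag_carries g k" "q \<noteq> 0" by blast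
    then have "young_Y g k \<in> complete_young (card (diag_carries g k))"
      by (rule young_Y_complete[OF assms(1,2)])
    moreover have "card (diag_carries g k) = m" using card card_S assms(3) by linarith
    ultimately show "young_Y g k \<in> complete_young m" by simp
  qed
qed

end
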